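(* Let $v_{\infty1}>v_{\infty2}>0$ and $n_1>n_2>1$. Then two distinct contact manifolds exist in $\mathcal D$, namely $$\mathcal C(\Phi^\infty)=\partial^\infty=\{\Phi=(\phi_1,\phi_2)^{\mathrm T}\in\mathcal D:\phi_1+\phi_2=1\},\qquad \mathcal C(\Phi^{\mathrm x})=\{\Phi=(\phi_1,\phi_2)^{\mathrm T}\in\mathcal D:\phi_1+\phi_2=\phi^{\mathrm x}\}.$$ The first is represented by any state $\Phi^\infty\in\partial^\infty$. The second, which is distinct from the first, is represented by the state $$\Phi^{\mathrm x}=(\phi^{\mathrm x},0)^{\mathrm T},\qquad \phi^{\mathrm x}=1-(v_{\infty2}/v_{\infty1})^{1/(n_1-n_2)}.$$
   Context: Phase space: $\mathcal D=\{\Phi=(\phi_1,\phi_2)^{\mathrm T}\in\mathbb R^2:\phi_1\ge0,\ \phi_2\ge0,\ \phi:=\phi_1+\phi_2\le 1\}$ (maximum packing concentration equal to $1$). On $\mathcal D$ set $u_i(\Phi)=v_{\infty i}(1-\phi)^{n_i-1}$, $v_i(\Phi)=u_i(\Phi)-\phi_1u_1(\Phi)-\phi_2u_2(\Phi)$, $f_i(\Phi)=\phi_iv_i(\Phi)$ for $i=1,2$, and $\boldsymbol f=(f_1,f_2)^{\mathrm T}$; the system is $\partial_t\phi_i+\partial_xf_i(\Phi)=0$. For a state $\Phi^\star\in\mathcal D$ with $v_1(\Phi^\star)=v_2(\Phi^\star)$ put $\mathcal C(\Phi^\star)=\{\Phi\in\mathcal D:v_1(\Phi)=v_2(\Phi)=v_1(\Phi^\star)\}$;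 $\Phi^\star$ is called a representative of this set. The Hugoniot locus $\mathcal H(\Phi^-)$ is the set of $\Phi^+\in\mathcal D$ for which there is a real $\sigma=\sigma(\Phi^-,\Phi^+)$ with $\boldsymbol f(\Phi^+)-\boldsymbol f(\Phi^-)=\sigma(\Phi^+-\Phi^-)$. Let $\lambda_1\le\lambda_2$ be the eigenvalues of the Jacobian matrix of $\boldsymbol f$, given by $\lambda_{1,2}=\tfrac12(v_1+v_2)-\tfrac12(n_1\phi_1u_1+n_2\phi_2u_2)\mp\tfrac12\sqrt{\Delta_\Phi}$, with $\Delta_\Phi=[(n_1\phi_1-1)u_1-(n_2\phi_2-1)u_2]^2+4n_1n_2\phi_1\phi_2u_1u_2$; at states with $\phi=1$ they are understood through this formula. An $i$-th integral curve is a curve in $\mathcal D$ whose tangent vector at each point is an eigenvector of the Jacobian for $\lambda_i$ (the derivative of $\boldsymbol f$ in the tangent direction equals $\lambda_i$ times the tangent; at $\phi=1$ this is understood via the directional derivative). An $i$-th contact manifold occurs when the $i$-th integral curve through a state $\Phi^o$ coincides with a part of $\mathcal H(\Phi^o)$ such that every state $\Phi$ on this intersection satisfies $\lambda_i(\Phi^o)=\sigma(\Phi^o,\Phi)=\lambda_i(\Phi)$. A contact manifold is an $i$-th contact manifold for some $i\in\{1,2\}$. *)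

theory Defs
  imports "HOL-Analysis.Analysis"
begin

text \<open>
  Species and characteristic families are both indexed by the two-element type \<^typ>\<open>2\<close>, whose
  elements are \<^term>\<open>1::2\<close> and \<^term>\<open>2::2\<close>.  The parameters \<open>v\<^sub>\<infinity>\<^sub>i\<close> and \<open>n\<^sub>i\<close> are the
  components of \<open>vinf n :: real ^ 2\<close>.
\<close>

definition total :: "real ^ 2 \<Rightarrow> real"
  where "total \<Phi> = \<Phi> $ 1 + \<Phi> $ 2"

definition phase_space :: "(real ^ 2) set"
  where "phase_space = {\<Phi>. \<Phi> $ 1 \<ge> 0 \<and> \<Phi> $ 2 \<ge> 0 \<and> total \<Phi> \<le> 1}"

definition vel_u :: "real ^ 2 \<Rightarrow> real ^ 2 \<Rightarrow> 2 \<Rightarrow> real ^ 2 \<Rightarrow> real"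
  where "vel_u vinf n i \<Phi> = vinf $ i * (1 - total \<Phi>) powr (n $ i - 1)"

definition vel :: "real ^ 2 \<Rightarrow> real ^ 2 \<Rightarrow> 2 \<Rightarrow> real ^ 2 \<Rightarrow> real"
  where "vel vinf n i \<Phi> =
    vel_u vinf n i \<Phi> - \<Phi> $ 1 * vel_u vinf n 1 \<Phi> - \<Phi> $ 2 * vel_u vinf n 2 \<Phi>"

definition flux :: "real ^ 2 \<Rightarrow> real ^ 2 \<Rightarrow> real ^ 2 \<Rightarrow> real ^ 2"
  where "flux vinf n \<Phi> = (\<chi> i. \<Phi> $ i * vel vinf n i \<Phi>)"

definition equal_velocity_set :: "real ^ 2 \<Rightarrow> real ^ 2 \<Rightarrow> real ^ 2 \<Rightarrow> (real ^ 2) set"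
  where "equal_velocity_set vinf n \<Phi>s =
    {\<Phi> \<in> phase_space. vel vinf n 1 \<Phi> = vel vinf n 2 \<Phi> \<and> vel vinf n 2 \<Phi> = vel vinf n 1 \<Phi>s}"

text \<open>\<open>\<Phi>s\<close> is a representative of the set \<open>C\<close>.\<close>

definition represents :: "real ^ 2 \<Rightarrow> real ^ 2 \<Rightarrow> real ^ 2 \<Rightarrow> (real ^ 2) set \<Rightarrow> bool"
  where "represents vinf n \<Phi>s C \<longleftrightarrow>
    \<Phi>s \<in> phase_space \<and> vel vinf n 1 \<Phi>s = vel vinf n 2 \<Phi>s \<and> C = equal_velocity_set vinf n \<Phi>s"

definition rankine_hugoniot :: "real ^ 2 \<Rightarrow> real ^ 2 \<Rightarrow> real ^ 2 \<Rightarrow> real ^ 2 \<Rightarrow> real \<Rightarrow> bool"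
  where "rankine_hugoniot vinf n \<Phi>m \<Phi>p \<sigma> \<longleftrightarrow>
    flux vinf n \<Phi>p - flux vinf n \<Phi>m = \<sigma> *\<^sub>R (\<Phi>p - \<Phi>m)"

definition hugoniot_locus :: "real ^ 2 \<Rightarrow> real ^ 2 \<Rightarrow> real ^ 2 \<Rightarrow> (real ^ 2) set"
  where "hugoniot_locus vinf n \<Phi>m =
    {\<Phi>p \<in> phase_space. \<exists>\<sigma>. rankine_hugoniot vinf n \<Phi>m \<Phi>p \<sigma>}"

definition discr :: "real ^ 2 \<Rightarrow> real ^ 2 \<Rightarrow> real ^ 2 \<Rightarrow> real"
  where "discr vinf n \<Phi> =
    ((n $ 1 * \<Phi> $ 1 - 1) * vel_u vinf n 1 \<Phi> - (n $ 2 * \<Phi> $ 2 - 1) * vel_u vinf n 2 \<Phi>)\<^sup>2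
    + 4 * n $ 1 * n $ 2 * \<Phi> $ 1 * \<Phi> $ 2 * vel_u vinf n 1 \<Phi> * vel_u vinf n 2 \<Phi>"

definition eigval :: "real ^ 2 \<Rightarrow> real ^ 2 \<Rightarrow> 2 \<Rightarrow> real ^ 2 \<Rightarrow> real"
  where "eigval vinf n i \<Phi> =
    (vel vinf n 1 \<Phi> + vel vinf n 2 \<Phi>) / 2
    - (n $ 1 * \<Phi> $ 1 * vel_u vinf n 1 \<Phi> + n $ 2 * \<Phi> $ 2 * vel_u vinf n 2 \<Phi>) / 2
    + (if i = 1 then - 1 else 1) * sqrt (discr vinf n \<Phi>) / 2"

text \<open>
  For \<open>\<phi> < 1\<close> the formula for the flux is smooth in a full neighbourhood of the state, also on the
  axes, and the Jacobian is the ordinary one.  For \<open>\<phi> = 1\<close> the Jacobian need not exist (if some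
  \<open>n\<^sub>i < 2\<close>), and the derivative in the direction \<open>T\<close> is the limit of difference quotients taken
  inside the phase space (one-sided if \<open>T\<close> or \<open>-T\<close> leaves it).
\<close>

definition eigen_direction :: "real ^ 2 \<Rightarrow> real ^ 2 \<Rightarrow> 2 \<Rightarrow> real ^ 2 \<Rightarrow> real ^ 2 \<Rightarrow> bool"
  where "eigen_direction vinf n i \<Phi> T \<longleftrightarrow> T \<noteq> 0 \<and>
    (if total \<Phi> < 1
     then jacobian (flux vinf n) (at \<Phi>) *v T = eigval vinf n i \<Phi> *\<^sub>R T
     else ((\<lambda>h. (flux vinf n (\<Phi> + h *\<^sub>R T) - flux vinf n \<Phi>) /\<^sub>R h) \<longlongrightarrow> eigval vinf n i \<Phi> *\<^sub>R T)
            (at 0 within {h. \<Phi> + h *\<^sub>R T \<in> phase_space}))"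

text \<open>
  Integral curves are the traces of regular \<open>C\<^sup>1\<close> parametrizations over nondegenerate intervals,
  which may be open, closed or half-open.
\<close>

definition integral_curve :: "real ^ 2 \<Rightarrow> real ^ 2 \<Rightarrow> 2 \<Rightarrow> (real ^ 2) set \<Rightarrow> bool"
  where "integral_curve vinf n i C \<longleftrightarrow> C \<subseteq> phase_space \<and>
    (\<exists>(I :: real set) \<gamma> \<gamma>'. is_interval I \<and> (\<exists>a\<in>I. \<exists>b\<in>I. a < b) \<and> C = \<gamma> ` I \<and>
      (\<forall>t\<in>I. (\<gamma> has_vector_derivative \<gamma>' t) (at t within I)) \<and> continuous_on I \<gamma>' \<and>
      (\<forall>t\<in>I. eigen_direction vinf n i (\<gamma> t) (\<gamma>' t)))"

text \<open>\<^emph>\<open>The\<close> integral curve through a state is one that cannot be extended.\<close>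

definition maximal_integral_curve :: "real ^ 2 \<Rightarrow> real ^ 2 \<Rightarrow> 2 \<Rightarrow> (real ^ 2) set \<Rightarrow> bool"
  where "maximal_integral_curve vinf n i C \<longleftrightarrow>
    integral_curve vinf n i C \<and> \<not> (\<exists>C'. integral_curve vinf n i C' \<and> C \<subset> C')"

text \<open>
  The speed \<open>\<sigma>(\<Phi>o, \<Phi>)\<close> is unique for \<open>\<Phi> \<noteq> \<Phi>o\<close>; for \<open>\<Phi> = \<Phi>o\<close> every real number is a speed, so the
  condition on the speed is void there.
\<close>

definition family_contact_manifold :: "real ^ 2 \<Rightarrow> real ^ 2 \<Rightarrow> 2 \<Rightarrow> (real ^ 2) set \<Rightarrow> bool"
  where "family_contact_manifold vinf n i C \<longleftrightarrow>
    (\<exists>\<Phi>o\<in>C. maximal_integral_curve vinf n i C \<and> C \<subseteq> hugoniot_locus vinf n \<Phi>o \<and>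
      (\<forall>\<Phi>\<in>C. rankine_hugoniot vinf n \<Phi>o \<Phi> (eigval vinf n i \<Phi>o) \<and>
              eigval vinf n i \<Phi> = eigval vinf n i \<Phi>o))"

definition contact_manifold :: "real ^ 2 \<Rightarrow> real ^ 2 \<Rightarrow> (real ^ 2) set \<Rightarrow> bool"
  where "contact_manifold vinf n C \<longleftrightarrow> (\<exists>i. family_contact_manifold vinf n i C)"

definition boundary_inf :: "(real ^ 2) set"
  where "boundary_inf = {\<Phi> \<in> phase_space. \<Phi> $ 1 + \<Phi> $ 2 = 1}"

definition phi_x :: "real ^ 2 \<Rightarrow> real ^ 2 \<Rightarrow> real"
  where "phi_x vinf n = 1 - (vinf $ 2 / vinf $ 1) powr (1 / (n $ 1 - n $ 2))"

definition Phi_x :: "real ^ 2 \<Rightarrow> real ^ 2 \<Rightarrow> real ^ 2"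
  where "Phi_x vinf n = vector [phi_x vinf n, 0]"

end

theory Submission
  imports Defs
begin

text \<open>
  On a contact manifold \<open>f - \<lambda>\<Phi>\<close> is constant, with \<open>\<lambda>\<close> fixed.  Eliminating \<open>\<phi>\<^sub>1\<close> and \<open>\<phi>\<^sub>2\<close> from
  these two equations gives a nontrivial linear relation between real powers of \<open>1 - \<phi>\<close>, which can
  hold on no interval; so \<open>\<phi>\<close> is constant and the tangent is a multiple of \<open>(1, -1)\<close>.  For \<open>\<phi> < 1\<close>
  this direction is an eigenvector only if \<open>u\<^sub>1 = u\<^sub>2\<close>, i.e. \<open>\<phi> = \<phi>\<^sup>x\<close>, and then only for the second
  family.  Maximality makes the manifold a whole level line of \<open>\<phi>\<close>.

  Conversely, an integral curve containing one of the two lines has its own endpoints at those of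
  the line.  At \<open>\<phi> = 1\<close> every direction may be an eigenvector (if \<open>n\<^sub>2 > 2\<close>), so leaving the boundary
  tangentially has to be excluded; the boundary is viewed as a first-family curve because
  first-family curves are never tangent to a level line inside.  A second-family curve cannot leave
  the line \<open>\<phi> = \<phi>\<^sup>x\<close> since \<open>y = \<phi> - \<phi>\<^sup>x\<close> satisfies \<open>y' = k y\<close> with \<open>k\<close> bounded near the line.
\<close>

section \<open>Real functions\<close>

text \<open>Induction on the number of other terms. Dividing by \<open>w powr e0\<close> makes one
  of them constant, and differentiation removes it while multiplying the distinguished coefficient
  by \<open>m - e0\<close>, which is nonzero. The exponents in \<open>xs\<close> may repeat; they
  only have to differ from \<open>m\<close>.\<close>

lemma generalized_polynomial_top_coeff_zero:
  fixes xs :: "(real \<times> real) list"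
  assumes "0 \<le> a" "a < b"
    and "\<And>w. a < w \<Longrightarrow> w < b \<Longrightarrow> c * w powr m + (\<Sum>(d, e)\<leftarrow>xs. d * w powr e) = 0"
    and "\<And>d e. (d, e) \<in> set xs \<Longrightarrow> e \<noteq> m"
  shows "c = 0"
  using assms(3,4)
proof (induction "length xs" arbitrary: c m xs)
  case 0
  have "c * ((a + b) / 2) powr m = 0"
    using 0(2)[of "(a + b) / 2"] 0(1) assms(1,2) by simp
  then show ?case
    using assms(1,2) by (simp add: powr_def)
next
  case (Suc k)
  obtain d0 e0 ys where xs: "xs = (d0, e0) # ys"
    using Suc.hyps(2) by (metis length_Suc_conv surj_pair)
  \<comment> \<open>These are the remaining terms after division by \<open>w powr e0\<close> and
    differentiation.\<close>
  let ?zs = "map (\<lambda>(d, e). (d * (e - e0), e - e0 - 1)) ys"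
  have deriv: "((\<lambda>w. \<Sum>(d, e)\<leftarrow>us. d * w powr (e - e0)) has_real_derivative
      (\<Sum>(d, e)\<leftarrow>map (\<lambda>(d, e). (d * (e - e0), e - e0 - 1)) us. d * w powr e)) (at w)"
    if "0 < w" for us :: "(real \<times> real) list" and w
  proof (induction us)
    case (Cons u us)
    show ?case
      using that by (cases u) (auto intro!: derivative_eq_intros Cons)
  qed simp
  have "c * (m - e0) = 0"
  proof (rule Suc.hyps(1)[of ?zs])
    show "k = length ?zs" using Suc.hyps(2) xs by simp
  next
    fix w assume w: "a < w" "w < b"
    then have w0: "0 < w" using assms(1) by simp
    let ?h = "\<lambda>w. c * w powr (m - e0) + d0 + (\<Sum>(d, e)\<leftarrow>ys. d * w powr (e - e0))"
    have zero: "?h x = 0" if "x \<in> {a<..<b}" for x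
    proof -
      have x0: "0 < x" using that assms(1) by simp
      have "(\<Sum>(d, e)\<leftarrow>ys. d * x powr (e - e0)) = (\<Sum>(d, e)\<leftarrow>ys. d * x powr e) / x powr e0"
        by (induction ys) (auto simp: powr_diff add_divide_distrib)
      then have "?h x = (c * x powr m + (\<Sum>(d, e)\<leftarrow>xs. d * x powr e)) / x powr e0"
        using x0 by (simp add: xs powr_diff add_divide_distrib)
      then show ?thesis using Suc.prems(1)[of x] that by simp
    qed
    have "(?h has_real_derivative
        c * ((m - e0) * w powr (m - e0 - 1)) + 0 + (\<Sum>(d, e)\<leftarrow>?zs. d * w powr e)) (at w)"
      by (rule DERIV_add DERIV_cmult DERIV_const deriv has_real_derivative_powr w0)+
    moreover have "(?h has_real_derivative 0) (at w)"
      by (rule has_field_derivative_transform_within_open[where S="{a<..<b}" and f="\<lambda>_. 0"])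
        (use w zero in auto)
    ultimately show "c * (m - e0) * w powr (m - e0 - 1) + (\<Sum>(d, e)\<leftarrow>?zs. d * w powr e) = 0"
      using DERIV_unique by fastforce
  next
    fix d e assume "(d, e) \<in> set ?zs"
    then show "e \<noteq> m - e0 - 1" using Suc.prems(2) xs by fastforce
  qed
  moreover have "e0 \<noteq> m" using Suc.prems(2)[of d0 e0] xs by simp
  ultimately show ?case by simp
qed

text \<open>Points of \<open>I\<close> on both sides put \<open>t\<close> into the interior of
  \<open>I\<close>, so the derivative within \<open>I\<close> is two-sided and the classical
  criterion for local extrema applies.\<close>

lemma has_real_derivative_interior_extremum:
  fixes g :: "real \<Rightarrow> real"
  assumes "is_interval I" "a \<in> I" "b \<in> I" "a < t" "t < b"
    and der: "(g has_real_derivative D) (at t within I)"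
    and ext: "(\<forall>s\<in>I. g t \<le> g s) \<or> (\<forall>s\<in>I. g s \<le> g t)"
  shows "D = 0"
proof -
  have sub: "{a<..<b} \<subseteq> I"
    using assms(1-3) unfolding is_interval_1 by (meson greaterThanLessThan_iff less_imp_le subsetI)
  then have "t \<in> interior I"
    using assms(4,5) by (meson greaterThanLessThan_iff interior_maximal open_greaterThanLessThan subsetD)
  from at_within_interior[OF this] have der': "(g has_real_derivative D) (at t)"
    using der by simp
  define d where "d = min (t - a) (b - t)"
  have "0 < d" using assms(4,5) by (simp add: d_def)
  have d: "y \<in> I" if "\<bar>t - y\<bar> < d" for y
    using that by (intro subsetD[OF sub]) (auto simp: d_def abs_less_iff)
  from ext show ?thesis
  proof
    assume "\<forall>s\<in>I. g t \<le> g s"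
    with d show ?thesis by (intro DERIV_local_min[OF der' \<open>0 < d\<close>]) simp
  next
    assume "\<forall>s\<in>I. g s \<le> g t"
    with d show ?thesis by (intro DERIV_local_max[OF der' \<open>0 < d\<close>]) simp
  qed
qed

text \<open>Each of the two points has \<open>I\<close> on one side only, so both are ends of
  \<open>I\<close>. This will show that a curve containing a whole level line has a compact
  parameter interval.\<close>

lemma interval_eq_Icc_if_not_interior:
  fixes I :: "real set"
  assumes I: "is_interval I" "s \<in> I" "t \<in> I" "s \<noteq> t"
    and s: "\<not> (\<exists>a\<in>I. \<exists>b\<in>I. a < s \<and> s < b)"
    and t: "\<not> (\<exists>a\<in>I. \<exists>b\<in>I. a < t \<and> t < b)"
  shows "I = {min s t..max s t}"
proof
  show "I \<subseteq> {min s t..max s t}"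
  proof
    fix x assume "x \<in> I"
    then show "x \<in> {min s t..max s t}"
    proof (cases "s < t")
      case True
      then have "\<not> x < s" "\<not> t < x" using I(2,3) s t \<open>x \<in> I\<close> by blast+
      then show ?thesis using True by simp
    next
      case False
      then have "t < s" using I(4) by simp
      then have "\<not> x < t" "\<not> s < x" using I(2,3) s t \<open>x \<in> I\<close> by blast+
      then show ?thesis using \<open>t < s\<close> by simp
    qed
  qed
  show "{min s t..max s t} \<subseteq> I"
  proof
    fix x assume x: "x \<in> {min s t..max s t}"
    have "min s t \<in> I" "max s t \<in> I" using I(2,3) by (simp_all add: min_def max_def)
    from mem_is_interval_1_I[OF I(1) this] x show "x \<in> I" by simp
  qed
qed

text \<open>The square makes the bound independent of the sign of \<open>y\<close>.\<close>

lemma gronwall_zero: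
  fixes y :: "real \<Rightarrow> real"
  assumes "a \<le> b"
    and cont: "continuous_on {a..b} y"
    and der: "\<And>t. a < t \<Longrightarrow> t < b \<Longrightarrow> (y has_real_derivative k t * y t) (at t)"
    and bound: "\<And>t. a < t \<Longrightarrow> t < b \<Longrightarrow> k t \<le> B"
    and "y a = 0"
  shows "y b = 0"
proof -
  define z where "z t = (y t)\<^sup>2 * exp (- 2 * B * t)" for t
  have "z b \<le> z a"
  proof (rule DERIV_nonpos_imp_decreasing_open[OF assms(1)])
    fix t assume t: "a < t" "t < b"
    have "(z has_real_derivative 2 * (k t - B) * ((y t)\<^sup>2 * exp (- 2 * B * t))) (at t)"
      unfolding z_def using der[OF t]
      by (auto intro!: derivative_eq_intros simp: algebra_simps power2_eq_square)
    moreover have "2 * (k t - B) * ((y t)\<^sup>2 * exp (- 2 * B * t)) \<le> 0"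
      by (rule mult_nonpos_nonneg) (use bound[OF t] in simp_all)
    ultimately show "\<exists>D. (z has_real_derivative D) (at t) \<and> D \<le> 0" by blast
  next
    show "continuous_on {a..b} z"
      unfolding z_def by (intro continuous_intros cont)
  qed
  then have "(y b)\<^sup>2 * exp (- 2 * B * b) \<le> 0"
    using assms(5) by (simp add: z_def)
  then show ?thesis
    by (simp add: mult_le_0_iff)
qed

section \<open>Eigenvectors\<close>

lemma has_derivative_vec2I:
  fixes f :: "'a::real_normed_vector \<Rightarrow> real ^ 2"
  assumes "\<And>i. ((\<lambda>x. f x $ i) has_derivative (\<lambda>T. f' T $ i)) (at x within S)"
  shows "(f has_derivative f') (at x within S)"
  unfolding has_derivative_componentwise_within[of f]
  using assms by (auto simp: Basis_vec_def inner_axis)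

lemma bounded_linear_total: "bounded_linear total"
  unfolding total_def by (intro bounded_linear_add bounded_linear_vec_nth)

lemma vector_eq_iff_2: "x = y \<longleftrightarrow> x $ 1 = y $ 1 \<and> x $ 2 = y $ 2" for x y :: "'a ^ 2"
  by (simp add: vec_eq_iff forall_2)

section \<open>Parameters and the derivative of the flux\<close>

locale two_species =
  fixes vinf n :: "real ^ 2"
  assumes vinf: "vinf $ 1 > vinf $ 2" "vinf $ 2 > 0"
    and n: "n $ 1 > n $ 2" "n $ 2 > 1"
begin

abbreviation "u \<equiv> vel_u vinf n"
abbreviation "v \<equiv> vel vinf n"
abbreviation "lam \<equiv> eigval vinf n"

text \<open>The derivative of \<open>u i\<close> in direction \<open>T\<close>, valid below maximal
  concentration. Writing the lowered power as a quotient keeps it a multiple of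
  \<open>u i\<close>.\<close>

definition du :: "2 \<Rightarrow> real ^ 2 \<Rightarrow> real ^ 2 \<Rightarrow> real"
  where "du i \<Phi> T = - (n $ i - 1) * u i \<Phi> / (1 - total \<Phi>) * total T"

lemma vel_u_has_derivative:
  assumes "total \<Phi> < 1"
  shows "(u i has_derivative du i \<Phi>) (at \<Phi>)"
proof -
  have "((\<lambda>s. 1 - s) has_real_derivative - 1) (at (total \<Phi>))"
    by (auto intro!: derivative_eq_intros)
  then have "((\<lambda>s. vinf $ i * (1 - s) powr (n $ i - 1)) has_real_derivative
      - (n $ i - 1) * u i \<Phi> / (1 - total \<Phi>)) (at (total \<Phi>))"
  proof (rule DERIV_cong[OF DERIV_cmult[OF DERIV_fun_powr]])
    have "(1 - total \<Phi>) powr (n $ i - 1 - of_nat 1) = (1 - total \<Phi>) powr (n $ i - 1) / (1 - total \<Phi>)"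
      using assms powr_diff[of "1 - total \<Phi>" "n $ i - 1" 1] by simp
    then show "vinf $ i * ((n $ i - 1) * (1 - total \<Phi>) powr (n $ i - 1 - of_nat 1) * - 1) =
        - (n $ i - 1) * u i \<Phi> / (1 - total \<Phi>)"
      by (simp only: vel_u_def) (simp add: algebra_simps diff_divide_distrib)
  qed (use assms in simp)
  from DERIV_compose_FDERIV[OF this bounded_linear_imp_has_derivative[OF bounded_linear_total]]
  show ?thesis
    unfolding vel_u_def du_def by (simp add: mult.commute)
qed

definition dflux :: "real ^ 2 \<Rightarrow> real ^ 2 \<Rightarrow> real ^ 2"
  where "dflux \<Phi> T = (\<chi> i. T $ i * v i \<Phi> + \<Phi> $ i *
    (du i \<Phi> T - (T $ 1 * u 1 \<Phi> + \<Phi> $ 1 * du 1 \<Phi> T) - (T $ 2 * u 2 \<Phi> + \<Phi> $ 2 * du 2 \<Phi> T)))"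

lemma flux_has_derivative:
  assumes "total \<Phi> < 1"
  shows "(flux vinf n has_derivative dflux \<Phi>) (at \<Phi>)"
proof (rule has_derivative_vec2I)
  fix i
  note [derivative_intros] = vel_u_has_derivative[OF assms]
  have nth: "((\<lambda>x. x $ j) has_derivative (\<lambda>T. T $ j)) (at \<Phi>)" for j :: 2
    by (intro bounded_linear_imp_has_derivative bounded_linear_vec_nth)
  show "((\<lambda>x. flux vinf n x $ i) has_derivative (\<lambda>T. dflux \<Phi> T $ i)) (at \<Phi>)"
    unfolding flux_def vel_def dflux_def
    by (auto intro!: derivative_eq_intros nth simp: algebra_simps)
qed

lemma eigen_direction_iff:
  assumes "total \<Phi> < 1"
  shows "eigen_direction vinf n i \<Phi> T \<longleftrightarrow> T \<noteq> 0 \<and> dflux \<Phi> T = lam i \<Phi> *\<^sub>R T"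
proof -
  note D = flux_has_derivative[OF assms]
  have "frechet_derivative (flux vinf n) (at \<Phi>) = dflux \<Phi>"
    using frechet_derivative_at[OF D] by simp
  then have "jacobian (flux vinf n) (at \<Phi>) *v T = dflux \<Phi> T"
    unfolding jacobian_def using has_derivative_linear[OF D] by (simp add: matrix_works)
  then show ?thesis
    using assms by (simp add: eigen_direction_def)
qed

section \<open>States of equal velocity\<close>

abbreviation "mean_u \<Phi> \<equiv> \<Phi> $ 1 * u 1 \<Phi> + \<Phi> $ 2 * u 2 \<Phi>"
abbreviation "px \<equiv> phi_x vinf n"

definition level :: "real \<Rightarrow> (real ^ 2) set"
  where "level s = {\<Phi> \<in> phase_space. \<Phi> $ 1 + \<Phi> $ 2 = s}"

lemma phi_x_bounds: "0 < px" "px < 1"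
proof -
  have q: "0 < vinf $ 2 / vinf $ 1" "vinf $ 2 / vinf $ 1 < 1" using vinf by auto
  have "0 < 1 / (n $ 1 - n $ 2)" using n by simp
  from powr_less_mono2[OF this _ q(2)] q show "0 < px"
    by (simp add: phi_x_def)
  show "px < 1" using vinf by (simp add: phi_x_def)
qed

text \<open>Cancelling \<open>w powr (n $ 2 - 1)\<close> with
  \<open>w = 1 - total \<Phi> > 0\<close> leaves one power equation,
  \<open>w powr (n $ 1 - n $ 2) = vinf $ 2 / vinf $ 1\<close>, whose only positive solution is
  \<open>1 - px\<close>.\<close>

lemma vel_u_eq_iff:
  assumes "total \<Phi> < 1"
  shows "u 1 \<Phi> = u 2 \<Phi> \<longleftrightarrow> total \<Phi> = px"
proof -
  define w where "w = 1 - total \<Phi>"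
  have w: "0 < w" using assms by (simp add: w_def)
  have d: "0 < n $ 1 - n $ 2" using n by simp
  have q: "0 < vinf $ 2 / vinf $ 1" using vinf by simp
  have e: "w powr (n $ 1 - 1) = w powr (n $ 1 - n $ 2) * w powr (n $ 2 - 1)"
    by (simp flip: powr_add)
  have "u 1 \<Phi> = u 2 \<Phi> \<longleftrightarrow> vinf $ 1 * w powr (n $ 1 - n $ 2) = vinf $ 2"
    using w unfolding vel_u_def w_def[symmetric] e by simp
  also have "\<dots> \<longleftrightarrow> w powr (n $ 1 - n $ 2) = vinf $ 2 / vinf $ 1"
    using vinf by (simp add: field_simps)
  also have "\<dots> \<longleftrightarrow> w = (vinf $ 2 / vinf $ 1) powr (1 / (n $ 1 - n $ 2))"
  proof
    assume h: "w powr (n $ 1 - n $ 2) = vinf $ 2 / vinf $ 1"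
    show "w = (vinf $ 2 / vinf $ 1) powr (1 / (n $ 1 - n $ 2))"
      unfolding h[symmetric] using w d by (simp add: powr_powr)
  next
    assume h: "w = (vinf $ 2 / vinf $ 1) powr (1 / (n $ 1 - n $ 2))"
    show "w powr (n $ 1 - n $ 2) = vinf $ 2 / vinf $ 1"
      unfolding h using q d vinf by (simp add: powr_powr)
  qed
  also have "\<dots> \<longleftrightarrow> total \<Phi> = px"
    by (auto simp: w_def phi_x_def)
  finally show ?thesis .
qed

lemma vel_eq: "v i \<Phi> = u i \<Phi> - mean_u \<Phi>"
  by (simp add: vel_def)

lemma vel_u_pos: "total \<Phi> < 1 \<Longrightarrow> 0 < u i \<Phi>"
  using vinf exhaust_2[of i] by (auto simp: vel_u_def)

lemma total_eq_one:
  assumes "total \<Phi> = 1"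
  shows "u i \<Phi> = 0" "v i \<Phi> = 0" "flux vinf n \<Phi> = 0" "lam i \<Phi> = 0"
proof -
  \<comment> \<open>The convention \<open>0 powr x = 0\<close> agrees here with the true value, the
    exponents \<open>n $ i - 1\<close> being positive.\<close>
  show u0: "u i \<Phi> = 0" for i using assms by (simp add: vel_u_def)
  then show v0: "v i \<Phi> = 0" for i by (simp add: vel_def)
  show "flux vinf n \<Phi> = 0" by (simp add: flux_def v0 vec_eq_iff)
  show "lam i \<Phi> = 0" by (simp add: eigval_def u0 v0 discr_def)
qed

text \<open>On the line \<open>\<phi> = px\<close> this is
  \<open>lam 2 \<Phi> - lam 1 \<Phi>\<close>.\<close>

definition eigen_gap :: "real ^ 2 \<Rightarrow> real"
  where "eigen_gap \<Phi> = u 1 \<Phi> * (n $ 1 * \<Phi> $ 1 + n $ 2 * \<Phi> $ 2)"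

text \<open>With \<open>u 1 \<Phi> = u 2 \<Phi>\<close> the discriminant is the square of
  \<open>eigen_gap \<Phi>\<close>, which makes both eigenvalues explicit. The gap is positive since
  \<open>px > 0\<close> keeps the state away from the origin.\<close>

lemma level_phi_x:
  assumes "\<Phi> \<in> phase_space" "total \<Phi> = px"
  shows "u 1 \<Phi> = u 2 \<Phi>" "v i \<Phi> = u 1 \<Phi> * (1 - px)" "0 < eigen_gap \<Phi>"
    "lam 1 \<Phi> = u 1 \<Phi> * (1 - px) - eigen_gap \<Phi>" "lam 2 \<Phi> = u 1 \<Phi> * (1 - px)"
proof -
  show uu: "u 1 \<Phi> = u 2 \<Phi>" using vel_u_eq_iff[of \<Phi>] assms(2) phi_x_bounds by simp
  have "u i \<Phi> = u 1 \<Phi>" for i using exhaust_2[of i] uu by auto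
  then show v: "v i \<Phi> = u 1 \<Phi> * (1 - px)" for i
    unfolding vel_def assms(2)[symmetric] total_def by (simp add: algebra_simps flip: uu)
  have pos: "0 \<le> \<Phi> $ 1" "0 \<le> \<Phi> $ 2" "0 < \<Phi> $ 1 \<or> 0 < \<Phi> $ 2"
    using assms phi_x_bounds by (auto simp: phase_space_def total_def)
  have "0 < n $ 1 * \<Phi> $ 1 + n $ 2 * \<Phi> $ 2"
    using pos n by (auto intro: add_pos_nonneg add_nonneg_pos)
  then show s: "0 < eigen_gap \<Phi>"
    using vel_u_pos[of \<Phi> 1] assms(2) phi_x_bounds by (simp add: eigen_gap_def)
  have "discr vinf n \<Phi> = (eigen_gap \<Phi>)\<^sup>2"
    by (simp add: discr_def eigen_gap_def uu[symmetric] power2_eq_square algebra_simps)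
  then have "sqrt (discr vinf n \<Phi>) = eigen_gap \<Phi>" using s by simp
  then show "lam 1 \<Phi> = u 1 \<Phi> * (1 - px) - eigen_gap \<Phi>" "lam 2 \<Phi> = u 1 \<Phi> * (1 - px)"
    by (simp_all add: eigval_def v uu[symmetric] eigen_gap_def field_simps)
qed

text \<open>Each \<open>u i\<close> depends on \<open>\<phi>\<close> alone, so its derivative along
  \<open>T\<close> vanishes and only the weights in the mean velocity vary.\<close>

lemma dflux_along_level:
  assumes "total T = 0"
  shows "dflux \<Phi> T $ i = T $ i * v i \<Phi> - \<Phi> $ i * (T $ 1 * (u 1 \<Phi> - u 2 \<Phi>))"
proof -
  have "T $ 2 = - T $ 1" using assms by (simp add: total_def)
  then show ?thesis
    by (simp add: dflux_def du_def assms algebra_simps)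
qed

text \<open>Dividing the two components of the eigenvector equation by \<open>T $ 1\<close> and
  subtracting gives \<open>(u 1 \<Phi> - u 2 \<Phi>) * (1 - total \<Phi>) = 0\<close>. The
  eigenvalue is then the common velocity, which is \<open>lam 2 \<Phi>\<close> and exceeds
  \<open>lam 1 \<Phi>\<close> by the positive gap.\<close>

lemma eigen_direction_along_level:
  assumes "\<Phi> \<in> phase_space" "total \<Phi> < 1" "total T = 0" "eigen_direction vinf n i \<Phi> T"
  shows "i = 2" "total \<Phi> = px"
proof -
  have T2: "T $ 2 = - T $ 1" using assms(3) by (simp add: total_def)
  have E: "T \<noteq> 0" "dflux \<Phi> T = lam i \<Phi> *\<^sub>R T"
    using assms(4) eigen_direction_iff[OF assms(2)] by auto
  have T1: "T $ 1 \<noteq> 0" using E(1) T2 by (auto simp: vector_eq_iff_2)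
  have E': "T $ j * v j \<Phi> - \<Phi> $ j * (T $ 1 * (u 1 \<Phi> - u 2 \<Phi>)) = lam i \<Phi> * T $ j" for j
    using dflux_along_level[OF assms(3), of \<Phi> j] E(2) by simp
  have e1: "v 1 \<Phi> - \<Phi> $ 1 * (u 1 \<Phi> - u 2 \<Phi>) = lam i \<Phi>"
  proof -
    have "T $ 1 * (v 1 \<Phi> - \<Phi> $ 1 * (u 1 \<Phi> - u 2 \<Phi>)) = T $ 1 * lam i \<Phi>"
      using E'[of 1] by (simp add: algebra_simps)
    then show ?thesis using T1 by simp
  qed
  have e2: "v 2 \<Phi> + \<Phi> $ 2 * (u 1 \<Phi> - u 2 \<Phi>) = lam i \<Phi>"
  proof -
    have "T $ 1 * (v 2 \<Phi> + \<Phi> $ 2 * (u 1 \<Phi> - u 2 \<Phi>)) = T $ 1 * lam i \<Phi>"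
      using E'[of 2] by (simp add: algebra_simps T2)
    then show ?thesis using T1 by simp
  qed
  have "(u 1 \<Phi> - u 2 \<Phi>) * (1 - total \<Phi>) = 0"
    using e1 e2 by (simp add: vel_eq total_def algebra_simps)
  then have uu: "u 1 \<Phi> = u 2 \<Phi>" using assms(2) by simp
  then show px: "total \<Phi> = px" using vel_u_eq_iff[OF assms(2)] by simp
  have "lam i \<Phi> = u 1 \<Phi> * (1 - px)"
    using e1 uu level_phi_x(2)[OF assms(1) px, of 1] by simp
  then show "i = 2"
    using level_phi_x(3,4)[OF assms(1) px] exhaust_2[of i] by auto
qed

text \<open>Summing the two components of the eigenvector equation eliminates the derivative of the
  mean velocity.\<close>

definition transversal_rate :: "2 \<Rightarrow> real ^ 2 \<Rightarrow> real"
  where "transversal_rate i \<Phi> = lam i \<Phi> + mean_u \<Phi>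
    + (\<Phi> $ 1 * (n $ 1 - 1) * u 1 \<Phi> + \<Phi> $ 2 * (n $ 2 - 1) * u 2 \<Phi>) - (1 - total \<Phi>) * u 2 \<Phi>"

text \<open>Where the rate is nonzero, this expresses the speed at which a curve crosses level lines
  as a multiple of \<open>u 1 \<Phi> - u 2 \<Phi>\<close>, a quantity that vanishes at
  \<open>px\<close>. It is the source of the equation \<open>y' = k y\<close>.\<close>

lemma eigen_direction_total:
  assumes "total \<Phi> < 1" "eigen_direction vinf n i \<Phi> T"
  shows "(1 - total \<Phi>) * T $ 1 * (u 1 \<Phi> - u 2 \<Phi>) = total T * transversal_rate i \<Phi>"
proof -
  have E: "dflux \<Phi> T $ j = lam i \<Phi> * T $ j" for j
    using assms eigen_direction_iff[OF assms(1)] by simp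
  define d where "d = total T / (1 - total \<Phi>)"
  have q: "total T = d * (1 - total \<Phi>)" using assms(1) by (simp add: d_def)
  have du: "du j \<Phi> T = - (n $ j - 1) * u j \<Phi> * d" for j
    by (simp add: du_def d_def)
  define S where "S = T $ 1 * u 1 \<Phi> + T $ 2 * u 2 \<Phi>"
  define M where "M = \<Phi> $ 1 * (n $ 1 - 1) * u 1 \<Phi> + \<Phi> $ 2 * (n $ 2 - 1) * u 2 \<Phi>"
  have "lam i \<Phi> * total T = dflux \<Phi> T $ 1 + dflux \<Phi> T $ 2"
    unfolding E by (simp add: total_def algebra_simps)
  also have "\<dots> = S - total T * mean_u \<Phi> - d * M - total \<Phi> * (S - d * M)"
    unfolding dflux_def du vel_eq S_def M_def by (simp add: total_def algebra_simps)
  finally have "(1 - total \<Phi>) * S = total T * (lam i \<Phi> + mean_u \<Phi>) + d * (1 - total \<Phi>) * M"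
    by (simp add: algebra_simps)
  then have "(1 - total \<Phi>) * S = total T * (lam i \<Phi> + mean_u \<Phi> + M)"
    unfolding q by (simp add: algebra_simps)
  moreover have "S = T $ 1 * (u 1 \<Phi> - u 2 \<Phi>) + total T * u 2 \<Phi>"
    by (simp add: S_def total_def algebra_simps)
  ultimately show ?thesis
    by (simp add: transversal_rate_def M_def algebra_simps)
qed

text \<open>By positivity of the gap and continuity, the rate can be divided by near the
  line.\<close>

lemma transversal_rate_level_phi_x:
  assumes "\<Phi> \<in> phase_space" "total \<Phi> = px"
  shows "transversal_rate 2 \<Phi> = eigen_gap \<Phi>"
  using level_phi_x(1,5)[OF assms] assms(2)
  by (simp add: transversal_rate_def eigen_gap_def total_def algebra_simps)

lemma continuous_transversal_rate:
  assumes "total \<Phi> < 1"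
  shows "isCont (transversal_rate i) \<Phi>"
proof -
  have [continuous_intros]: "isCont (\<lambda>\<Phi>. \<Phi> $ j) \<Phi>" for j :: 2
    using isCont_vec_nth[OF continuous_ident] by simp
  have [continuous_intros]: "isCont total \<Phi>"
    unfolding total_def by (intro continuous_intros)
  have [continuous_intros]: "isCont (u j) \<Phi>" for j
    using has_derivative_continuous[OF vel_u_has_derivative[OF assms]] .
  show ?thesis
    unfolding transversal_rate_def eigval_def vel_def discr_def by (intro continuous_intros) auto
qed

text \<open>The flux vanishes on the whole line \<open>\<phi> = 1\<close>, so all difference
  quotients along it are zero, and so are both eigenvalues. The boundary therefore belongs to both
  families.\<close>

lemma eigen_direction_level_one:
  assumes "total \<Phi> = 1" "total T = 0" "T \<noteq> 0"
  shows "eigen_direction vinf n i \<Phi> T"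
proof -
  have "total (\<Phi> + h *\<^sub>R T) = 1" for h
    using assms(1,2) by (simp add: total_def algebra_simps flip: distrib_left)
  then have "flux vinf n (\<Phi> + h *\<^sub>R T) = 0" for h using total_eq_one(3) by blast
  then show ?thesis
    using assms(1,3) by (simp add: eigen_direction_def total_eq_one)
qed

lemma eigen_direction_level_phi_x:
  assumes "\<Phi> \<in> phase_space" "total \<Phi> = px" "total T = 0" "T \<noteq> 0"
  shows "eigen_direction vinf n 2 \<Phi> T"
proof -
  have less: "total \<Phi> < 1" using assms(2) phi_x_bounds by simp
  have "dflux \<Phi> T = lam 2 \<Phi> *\<^sub>R T"
    using dflux_along_level[OF assms(3), of \<Phi>] level_phi_x[OF assms(1,2)]
    by (simp add: vec_eq_iff)
  then show ?thesis
    using eigen_direction_iff[OF less] assms(4) by simp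
qed

section \<open>The two level lines as integral curves\<close>

lemma level_iff: "\<Phi> \<in> level s \<longleftrightarrow> \<Phi> \<in> phase_space \<and> total \<Phi> = s"
  by (simp add: level_def total_def)

lemma integral_curve_level:
  assumes "0 < s" "s \<le> 1"
    and eig: "\<And>\<Phi> T. \<Phi> \<in> level s \<Longrightarrow> total T = 0 \<Longrightarrow> T \<noteq> 0 \<Longrightarrow> eigen_direction vinf n i \<Phi> T"
  shows "integral_curve vinf n i (level s)"
proof -
  define \<gamma> where "\<gamma> t = (vector [t, s - t] :: real ^ 2)" for t
  define T where "T = (vector [1, - 1] :: real ^ 2)"
  have "level s = \<gamma> ` {0..s}"
  proof (intro set_eqI iffI)
    fix \<Phi> assume "\<Phi> \<in> level s"
    then have "\<Phi> = \<gamma> (\<Phi> $ 1)" "\<Phi> $ 1 \<in> {0..s}"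
      by (auto simp: level_def \<gamma>_def vector_eq_iff_2 phase_space_def)
    then show "\<Phi> \<in> \<gamma> ` {0..s}" by blast
  qed (use assms(2) in \<open>auto simp: level_def \<gamma>_def phase_space_def total_def\<close>)
  moreover have "(\<gamma> has_vector_derivative T) (at t within S)" for t S
    unfolding has_vector_derivative_def
  proof (rule has_derivative_vec2I)
    fix i :: 2
    show "((\<lambda>t. \<gamma> t $ i) has_derivative (\<lambda>x. (x *\<^sub>R T) $ i)) (at t within S)"
      using exhaust_2[of i] by (auto simp: \<gamma>_def T_def intro!: derivative_eq_intros)
  qed
  moreover have "total T = 0" "T \<noteq> 0" by (auto simp: total_def T_def vector_eq_iff_2)
  moreover have "\<exists>a\<in>{0..s}. \<exists>b\<in>{0..s}. a < b"
    using assms(1) by (intro bexI[of _ 0] bexI[of _ s]) simp_all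
  moreover have "level s \<subseteq> phase_space" by (auto simp: level_def)
  ultimately have "\<forall>t\<in>{0..s}. eigen_direction vinf n i (\<gamma> t) T" using eig by blast
  show ?thesis
    unfolding integral_curve_def
  proof (intro conjI exI)
    show "level s = \<gamma> ` {0..s}" by fact
    show "\<forall>t\<in>{0..s}. (\<gamma> has_vector_derivative (\<lambda>_. T) t) (at t within {0..s})"
      using \<open>\<And>t S. (\<gamma> has_vector_derivative T) (at t within S)\<close> by simp
    show "\<forall>t\<in>{0..s}. eigen_direction vinf n i (\<gamma> t) ((\<lambda>_. T) t)" by fact
  qed (fact | simp)+
qed

lemma integral_curve_level_one: "integral_curve vinf n i (level 1)"
  by (rule integral_curve_level) (auto simp: level_iff eigen_direction_level_one)

lemma integral_curve_level_phi_x: "integral_curve vinf n 2 (level px)"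
  using phi_x_bounds
  by (intro integral_curve_level) (auto simp: level_iff eigen_direction_level_phi_x)

end

section \<open>Integral curves\<close>

locale regular_curve = two_species +
  fixes i :: 2 and I :: "real set" and \<gamma> \<gamma>' :: "real \<Rightarrow> real ^ 2"
  assumes interval: "is_interval I" and nondegenerate: "\<exists>a\<in>I. \<exists>b\<in>I. a < b"
    and phase: "\<And>t. t \<in> I \<Longrightarrow> \<gamma> t \<in> phase_space"
    and deriv: "\<And>t. t \<in> I \<Longrightarrow> (\<gamma> has_vector_derivative \<gamma>' t) (at t within I)"
    and cont: "continuous_on I \<gamma>'"
    and eigen: "\<And>t. t \<in> I \<Longrightarrow> eigen_direction vinf n i (\<gamma> t) (\<gamma>' t)"
begin

lemma nth_deriv: "t \<in> I \<Longrightarrow> ((\<lambda>t. \<gamma> t $ j) has_real_derivative \<gamma>' t $ j) (at t within I)"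
  using bounded_linear.has_vector_derivative[OF bounded_linear_vec_nth deriv]
  by (simp add: has_real_derivative_iff_has_vector_derivative)

lemma total_deriv: "t \<in> I \<Longrightarrow> ((\<lambda>t. total (\<gamma> t)) has_real_derivative total (\<gamma>' t)) (at t within I)"
  using bounded_linear.has_vector_derivative[OF bounded_linear_total deriv]
  by (simp add: has_real_derivative_iff_has_vector_derivative)

lemma total_continuous: "continuous_on I (\<lambda>t. total (\<gamma> t))"
  by (simp add: continuous_on_eq_continuous_within) (intro ballI DERIV_continuous[OF total_deriv])

lemma deriv_nonzero: "t \<in> I \<Longrightarrow> \<gamma>' t \<noteq> 0"
  using eigen by (auto simp: eigen_direction_def)

text \<open>For the interval \<open>I\<close> this is membership in its interior, phrased by points
  on either side so that one-sided behaviour at included ends is kept apart.\<close>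

definition interior_time :: "real \<Rightarrow> bool"
  where "interior_time t \<longleftrightarrow> (\<exists>a\<in>I. \<exists>b\<in>I. a < t \<and> t < b)"

lemma interior_time_in: "interior_time t \<Longrightarrow> t \<in> I"
  unfolding interior_time_def using interval mem_is_interval_1_I by (metis less_imp_le)

lemma interior_axis_tangent:
  assumes "interior_time t" "\<gamma> t $ j = 0"
  shows "\<gamma>' t $ j = 0"
proof -
  obtain a b where ab: "a \<in> I" "b \<in> I" "a < t" "t < b" using assms(1) by (auto simp: interior_time_def)
  have "\<forall>s\<in>I. \<gamma> t $ j \<le> \<gamma> s $ j"
    using phase assms(2) exhaust_2[of j] by (auto simp: phase_space_def)
  with has_real_derivative_interior_extremum[OF interval ab nth_deriv[OF interior_time_in[OF assms(1)]]]
  show ?thesis by blast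
qed

lemma interior_total_extremum:
  assumes "interior_time t"
    and "(\<forall>s\<in>I. total (\<gamma> t) \<le> total (\<gamma> s)) \<or> (\<forall>s\<in>I. total (\<gamma> s) \<le> total (\<gamma> t))"
  shows "total (\<gamma>' t) = 0"
proof -
  obtain a b where ab: "a \<in> I" "b \<in> I" "a < t" "t < b" using assms(1) by (auto simp: interior_time_def)
  from has_real_derivative_interior_extremum[OF interval ab total_deriv[OF interior_time_in[OF assms(1)]]]
  show ?thesis using assms(2) by blast
qed

text \<open>At such a time one coordinate is minimal and \<open>\<phi>\<close> is maximal along the
  curve. Both derivatives would vanish, and together they determine the tangent, which is
  nonzero.\<close>

lemma not_interior_corner:
  assumes "t \<in> I" "total (\<gamma> t) = 1" "\<gamma> t $ j = 0"
  shows "\<not> interior_time t"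
proof
  assume interior_time: "interior_time t"
  have "\<gamma>' t $ j = 0" using interior_axis_tangent[OF interior_time assms(3)] .
  moreover have "total (\<gamma>' t) = 0"
    by (rule interior_total_extremum[OF interior_time]) (use assms(2) phase in \<open>auto simp: phase_space_def\<close>)
  ultimately have "\<gamma>' t = 0"
    using exhaust_2[of j] by (auto simp: vector_eq_iff_2 total_def)
  then show False using deriv_nonzero assms(1) by blast
qed

text \<open>Again two derivatives would vanish: that of the coordinate by minimality, and that of
  \<open>\<phi>\<close> because second-family eigenvectors on this line are tangent to it.\<close>

lemma not_interior_axis_phi_x:
  assumes "i = 2" "t \<in> I" "total (\<gamma> t) = px" "\<gamma> t $ j = 0"
  shows "\<not> interior_time t"
proof
  assume interior_time: "interior_time t"
  have less: "total (\<gamma> t) < 1" using assms(3) phi_x_bounds by simp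
  have T: "\<gamma>' t $ j = 0" using interior_axis_tangent[OF interior_time assms(4)] .
  have "(1 - px) * \<gamma>' t $ 1 * (u 1 (\<gamma> t) - u 2 (\<gamma> t)) = total (\<gamma>' t) * eigen_gap (\<gamma> t)"
    using eigen_direction_total[OF less eigen[OF assms(2)]]
      transversal_rate_level_phi_x[OF phase[OF assms(2)] assms(3)] assms(1,3) by simp
  then have "total (\<gamma>' t) = 0"
    using level_phi_x(1,3)[OF phase[OF assms(2)] assms(3)] by simp
  with T have "\<gamma>' t = 0"
    using exhaust_2[of j] by (auto simp: vector_eq_iff_2 total_def)
  then show False using deriv_nonzero assms(2) by blast
qed

text \<open>The curve passes through the states \<open>(s, 0)\<close> and \<open>(0, s)\<close>,
  neither at an interior time, so these two times are the ends of \<open>I\<close>.\<close>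

lemma interval_from_level_ends:
  assumes "0 < s" "s \<le> 1" "level s \<subseteq> \<gamma> ` I"
    and ends: "\<And>t j. t \<in> I \<Longrightarrow> total (\<gamma> t) = s \<Longrightarrow> \<gamma> t $ j = 0 \<Longrightarrow> \<not> interior_time t"
  obtains p q where "p < q" "I = {p..q}" "total (\<gamma> p) = s" "total (\<gamma> q) = s"
proof -
  have "vector [s, 0] \<in> level s" "vector [0, s] \<in> level s"
    using assms(1,2) by (auto simp: level_def phase_space_def total_def)
  from this[THEN subsetD[OF assms(3)]]
  obtain a b where a: "a \<in> I" "\<gamma> a = vector [s, 0]" and b: "b \<in> I" "\<gamma> b = vector [0, s]"
    by (auto simp: image_iff)
  have tot: "total (\<gamma> a) = s" "total (\<gamma> b) = s" using a b by (simp_all add: total_def)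
  have "a \<noteq> b"
  proof
    assume "a = b"
    then have "(vector [s, 0] :: real ^ 2) $ 1 = (vector [0, s] :: real ^ 2) $ 1" using a b by simp
    then show False using assms(1) by simp
  qed
  moreover have "\<not> interior_time a" "\<not> interior_time b"
    using ends[OF a(1) tot(1), of 2] ends[OF b(1) tot(2), of 1] a b by simp_all
  ultimately have "I = {min a b..max a b}"
    using interval_eq_Icc_if_not_interior[OF interval a(1) b(1)] by (simp add: interior_time_def)
  with \<open>a \<noteq> b\<close> tot show ?thesis
    by (intro that[of "min a b" "max a b"]) (auto simp: min_def max_def)
qed

text \<open>A first-family curve with both ends on \<open>\<phi> = 1\<close> would have an interior minimum of \<open>\<phi>\<close>, where
  it is tangent to a level line; only the second family is, and only at \<open>\<phi>\<^sup>x\<close>.\<close>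

lemma level_one_not_extendable:
  assumes "i = 1" "level 1 \<subseteq> \<gamma> ` I"
  shows "\<gamma> ` I \<subseteq> level 1"
proof -
  obtain p q where pq: "p < q" "I = {p..q}" "total (\<gamma> p) = 1" "total (\<gamma> q) = 1"
    using interval_from_level_ends[OF _ _ assms(2)] not_interior_corner by auto
  have "compact {p..q}" "{p..q} \<noteq> {}" using pq(1) by auto
  from continuous_attains_inf[OF this total_continuous[unfolded pq(2)]]
  obtain t where t: "t \<in> I" and min: "\<forall>s\<in>I. total (\<gamma> t) \<le> total (\<gamma> s)"
    unfolding pq(2) by blast
  have "total (\<gamma> t) = 1"
  proof (rule ccontr)
    assume "total (\<gamma> t) \<noteq> 1"
    then have less: "total (\<gamma> t) < 1" using phase[OF t] by (simp add: phase_space_def)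
    then have "t \<noteq> p" "t \<noteq> q" using pq(3,4) by auto
    then have "p < t" "t < q" using t pq(2) by auto
    moreover have "p \<in> I" "q \<in> I" using pq(1,2) by simp_all
    ultimately have "interior_time t" unfolding interior_time_def by blast
    then have "total (\<gamma>' t) = 0" using interior_total_extremum min by blast
    from eigen_direction_along_level(1)[OF phase[OF t] less this eigen[OF t]] show False
      using assms(1) by simp
  qed
  then show ?thesis
    using min phase by (fastforce simp: level_iff phase_space_def)
qed

text \<open>Suppose the curve is off the line at \<open>t2\<close>, and let \<open>t1\<close> be the
  last earlier time on it. Just after \<open>t1\<close> the deviation \<open>y\<close> solves
  \<open>y' = k y\<close> with \<open>k\<close> bounded above, so \<open>gronwall_zero\<close>
  forces a further zero of \<open>y\<close>.\<close>

lemma level_phi_x_not_extendable: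
  assumes i: "i = 2" and sub: "level px \<subseteq> \<gamma> ` I"
  shows "\<gamma> ` I \<subseteq> level px"
proof (rule ccontr)
  assume "\<not> \<gamma> ` I \<subseteq> level px"
  then obtain t2 where "t2 \<in> I" "\<gamma> t2 \<notin> level px" by blast
  then have t2: "t2 \<in> I" "total (\<gamma> t2) \<noteq> px"
    using phase by (simp_all add: level_iff)
  obtain p q where pq: "p < q" "I = {p..q}" "total (\<gamma> p) = px" "total (\<gamma> q) = px"
    using interval_from_level_ends[OF _ _ sub] not_interior_axis_phi_x[OF i] phi_x_bounds by auto
  define y where "y t = total (\<gamma> t) - px" for t
  have y_cont: "continuous_on I y" unfolding y_def by (intro continuous_intros total_continuous)
  have sub2: "{p..t2} \<subseteq> I" using t2(1) pq(2) by auto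
  \<comment> \<open>The supremum is the last zero of \<open>y\<close> before \<open>t2\<close>;
    beyond it, division by \<open>y\<close> is legitimate.\<close>
  let ?S = "{t \<in> {p..t2}. y t = 0}"
  have "closed ?S"
    using continuous_closed_preimage_constant[OF continuous_on_subset[OF y_cont sub2]] by simp
  moreover have "p \<in> ?S" "bdd_above ?S" using t2 pq by (auto simp: y_def intro: bdd_aboveI[of _ t2])
  ultimately have "Sup ?S \<in> ?S" by (intro closed_contains_Sup) auto
  then obtain t1 where t1: "t1 = Sup ?S" "t1 \<in> {p..t2}" "y t1 = 0" by blast
  have "t1 \<noteq> t2" using t1(3) t2(2) by (auto simp: y_def)
  then have t12: "t1 < t2" using t1(2) by simp
  have y_nz: "y t \<noteq> 0" if "t1 < t" "t \<le> t2" for t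
  proof
    assume "y t = 0"
    then have "t \<in> ?S" using that t1(2) by simp
    then have "t \<le> t1" unfolding t1(1) using \<open>bdd_above ?S\<close> by (rule cSup_upper)
    then show False using that by simp
  qed
  have t1I: "t1 \<in> I" using t1(2) sub2 by blast
  have level1: "total (\<gamma> t1) = px" using t1(3) by (simp add: y_def)
  have sub3: "{t1..t2} \<subseteq> I" using t1(2) sub2 by auto
  let ?F = "at t1 within {t1..t2}"
  \<comment> \<open>As a function of \<open>\<phi>\<close> alone, \<open>u 1 - u 2\<close> has a
    zero at \<open>px\<close>. Hence \<open>g (total (\<gamma> t)) / y t\<close> is a difference
    quotient at \<open>px\<close>, with limit \<open>D\<close>.\<close>
  define g where "g s = vinf $ 1 * (1 - s) powr (n $ 1 - 1) - vinf $ 2 * (1 - s) powr (n $ 2 - 1)" for s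
  have g_u: "g (total \<Phi>) = u 1 \<Phi> - u 2 \<Phi>" for \<Phi> by (simp add: g_def vel_u_def)
  obtain D where D: "(g has_real_derivative D) (at px)"
  proof -
    have "((\<lambda>s. 1 - s) has_real_derivative - 1) (at px)" by (auto intro!: derivative_eq_intros)
    note d = DERIV_cmult[OF DERIV_fun_powr[OF this]]
    show ?thesis
      by (rule that, unfold g_def, rule DERIV_diff[OF d d]) (use phi_x_bounds in auto)
  qed
  have g0: "g px = 0"
    using g_u[of "\<gamma> t1"] level_phi_x(1)[OF phase[OF t1I] level1] level1 by simp
  have tot_lim: "((\<lambda>t. total (\<gamma> t)) \<longlongrightarrow> px) ?F"
    using total_continuous t1I
    by (intro tendsto_within_subset[OF _ sub3]) (simp add: continuous_on_def flip: level1)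
  \<comment> \<open>The filter \<open>at px\<close> omits \<open>px\<close> itself, so composing the
    limits requires \<open>y\<close> to be nonzero after \<open>t1\<close>.\<close>
  have F_ne: "\<forall>\<^sub>F t in ?F. y t \<noteq> 0"
    unfolding eventually_at_filter by (rule always_eventually) (use y_nz in auto)
  have "filterlim (\<lambda>t. total (\<gamma> t)) (at px) ?F"
    by (rule filterlim_atI[OF tot_lim]) (use F_ne in \<open>simp add: y_def\<close>)
  moreover have "((\<lambda>s. (g s - g px) / (s - px)) \<longlongrightarrow> D) (at px)"
    using D by (simp add: has_field_derivative_iff)
  ultimately have g_lim: "((\<lambda>t. g (total (\<gamma> t)) / y t) \<longlongrightarrow> D) ?F"
    using filterlim_compose[of "\<lambda>s. (g s - g px) / (s - px)" "nhds D" "at px" "\<lambda>t. total (\<gamma> t)" ?F]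
    by (simp add: g0 y_def)
  have gam_lim: "(\<gamma> \<longlongrightarrow> \<gamma> t1) ?F"
    using has_vector_derivative_continuous[OF deriv[OF t1I]]
    by (intro tendsto_within_subset[OF _ sub3]) (simp add: continuous_within)
  have less: "total (\<gamma> t1) < 1" using level1 phi_x_bounds by simp
  have R_lim: "((\<lambda>t. transversal_rate 2 (\<gamma> t)) \<longlongrightarrow> eigen_gap (\<gamma> t1)) ?F"
    using isCont_tendsto_compose[OF continuous_transversal_rate[OF less] gam_lim, of 2]
      transversal_rate_level_phi_x[OF phase[OF t1I] level1] by simp
  have eigen_gap: "0 < eigen_gap (\<gamma> t1)" using level_phi_x(3)[OF phase[OF t1I] level1] .
  have T_lim: "((\<lambda>t. \<gamma>' t $ 1) \<longlongrightarrow> \<gamma>' t1 $ 1) ?F"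
    using cont t1I by (intro tendsto_vec_nth tendsto_within_subset[OF _ sub3]) (simp add: continuous_on_def)
  \<comment> \<open>This is \<open>eigen_direction_total\<close> solved for
    \<open>total (\<gamma>' t) / y t\<close>. Every factor converges at \<open>t1\<close> and the
    denominator has a positive limit, which bounds \<open>k\<close> by \<open>L + 1\<close>
    nearby.\<close>
  define k where "k t = (1 - total (\<gamma> t)) * \<gamma>' t $ 1 * (g (total (\<gamma> t)) / y t) / transversal_rate 2 (\<gamma> t)" for t
  define L where "L = (1 - px) * \<gamma>' t1 $ 1 * D / eigen_gap (\<gamma> t1)"
  have "(k \<longlongrightarrow> L) ?F"
    unfolding k_def L_def using eigen_gap by (intro tendsto_intros tot_lim T_lim g_lim R_lim) simp
  then have "\<forall>\<^sub>F t in ?F. k t < L + 1" by (rule order_tendstoD(2)) simp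
  moreover have "\<forall>\<^sub>F t in ?F. 0 < transversal_rate 2 (\<gamma> t)" by (rule order_tendstoD(1)[OF R_lim eigen_gap])
  moreover have "\<forall>\<^sub>F t in ?F. total (\<gamma> t) < 1"
    by (rule order_tendstoD(2)[OF tot_lim]) (rule phi_x_bounds)
  ultimately have "\<forall>\<^sub>F t in ?F. k t < L + 1 \<and> 0 < transversal_rate 2 (\<gamma> t) \<and> total (\<gamma> t) < 1"
    by eventually_elim simp
  then obtain d where "0 < d" and near: "\<And>t. t \<in> {t1..t2} \<Longrightarrow> t \<noteq> t1 \<Longrightarrow> dist t t1 < d \<Longrightarrow>
      k t < L + 1 \<and> 0 < transversal_rate 2 (\<gamma> t) \<and> total (\<gamma> t) < 1"
    unfolding eventually_at by blast
  define b where "b = min t2 (t1 + d / 2)"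
  have b: "t1 < b" "b \<le> t2" "b < t1 + d" using t12 \<open>0 < d\<close> by (auto simp: b_def)
  have "y b = 0"
  proof (rule gronwall_zero[of t1 b y k "L + 1"])
    show "continuous_on {t1..b} y"
      by (rule continuous_on_subset[OF y_cont]) (use sub3 b in auto)
  next
    fix t assume t: "t1 < t" "t < b"
    then have tI: "t \<in> {t1..t2}" "t \<noteq> t1" "dist t t1 < d" using b by (auto simp: dist_real_def)
    note nr = near[OF tI]
    then show "k t \<le> L + 1" by simp
    have "t \<in> I" using tI(1) sub3 by blast
    have "y t \<noteq> 0" using y_nz t b by simp
    have "(1 - total (\<gamma> t)) * \<gamma>' t $ 1 * g (total (\<gamma> t)) = total (\<gamma>' t) * transversal_rate 2 (\<gamma> t)"
      using eigen_direction_total[OF _ eigen[OF \<open>t \<in> I\<close>]] nr i by (simp add: g_u)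
    then have "k t * y t = total (\<gamma>' t)"
      using nr \<open>y t \<noteq> 0\<close> by (simp add: k_def)
    moreover have "t \<in> interior I"
      by (rule interiorI[of "{t1<..<t2}"]) (use t b sub3 in auto)
    ultimately show "(y has_real_derivative k t * y t) (at t)"
      using DERIV_diff[OF total_deriv[OF \<open>t \<in> I\<close>] DERIV_const[of px]] at_within_interior[of t I]
      by (simp add: y_def[abs_def])
  qed (use t1(3) b in auto)
  then show False using y_nz b by blast
qed

end

section \<open>Contact manifolds\<close>

context two_species begin

lemma integral_curveE:
  assumes "integral_curve vinf n i C"
  obtains I \<gamma> \<gamma>' where "C = \<gamma> ` I" "regular_curve vinf n i I \<gamma> \<gamma>'"
proof -
  obtain I \<gamma> \<gamma>' where c: "is_interval I" "\<exists>a\<in>I. \<exists>b\<in>I. a < b" "C = \<gamma> ` I" "C \<subseteq> phase_space"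
    "\<forall>t\<in>I. (\<gamma> has_vector_derivative \<gamma>' t) (at t within I)" "continuous_on I \<gamma>'"
    "\<forall>t\<in>I. eigen_direction vinf n i (\<gamma> t) (\<gamma>' t)"
    using assms unfolding integral_curve_def by blast
  have "regular_curve vinf n i I \<gamma> \<gamma>'"
    by unfold_locales (use c in auto)
  with c(3) show ?thesis by (rule that)
qed

text \<open>With \<open>Q = \<lambda> + \<phi>\<^sub>1u\<^sub>1 + \<phi>\<^sub>2u\<^sub>2\<close> the Rankine-Hugoniot conditions at the fixed speed \<open>\<lambda>\<close> read
  \<open>\<phi>\<^sub>i(u\<^sub>i - Q) = c\<^sub>i\<close>.  Their sum says that \<open>K = Q(1 - \<phi>)\<close> is constant, and eliminating \<open>\<phi>\<^sub>1, \<phi>\<^sub>2\<close> leaves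
  an equation between real powers of \<open>w = 1 - \<phi>\<close>.\<close>

definition contact_terms :: "real \<Rightarrow> real \<Rightarrow> real \<Rightarrow> (real \<times> real) list"
  where "contact_terms K c1 c2 = (let V1 = vinf $ 1; V2 = vinf $ 2 in
    [(V1 * V2, n $ 1 + n $ 2), (- (K * V1), n $ 1), (- (K * V2), n $ 2),
     (K * V1 - c2 * V1, n $ 1 + 1), (K * V2 - c1 * V2, n $ 2 + 1),
     (K * K, 0), (K * c1 + K * c2 - K * K, 1)])"

lemma contact_power_equation:
  assumes c: "\<And>j. \<Phi> $ j * (v j \<Phi> - l) = c j" and less: "total \<Phi> < 1"
    and K: "K = l + c 1 + c 2" and w: "w = 1 - total \<Phi>"
  shows "- (vinf $ 1 * vinf $ 2) * w powr (n $ 1 + n $ 2 + 1)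
    + (\<Sum>(d, e)\<leftarrow>contact_terms K (c 1) (c 2). d * w powr e) = 0"
proof -
  have w0: "0 < w" using less w by simp
  define Q where "Q = l + mean_u \<Phi>"
  define A B where "A = vinf $ 1 * w powr n $ 1" and "B = vinf $ 2 * w powr n $ 2"
  have A: "u 1 \<Phi> * w = A" and B: "u 2 \<Phi> * w = B"
    using w0 by (simp_all add: vel_u_def A_def B_def w[symmetric] powr_diff)
  have cQ: "\<Phi> $ j * (u j \<Phi> - Q) = c j" for j
    using c[of j] by (simp add: vel_eq Q_def algebra_simps)
  have "Q - l - total \<Phi> * Q = c 1 + c 2"
    unfolding cQ[symmetric] by (simp add: Q_def total_def algebra_simps)
  then have Qw: "Q * w = K" by (simp add: K w algebra_simps)
  have A': "\<Phi> $ 1 * (A - K) = c 1 * w"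
    unfolding A[symmetric] Qw[symmetric] cQ[of 1, symmetric] by (simp add: algebra_simps)
  have B': "\<Phi> $ 2 * (B - K) = c 2 * w"
    unfolding B[symmetric] Qw[symmetric] cQ[of 2, symmetric] by (simp add: algebra_simps)
  \<comment> \<open>Multiplying \<open>\<phi>\<^sub>1 + \<phi>\<^sub>2 = 1 - w\<close> by both
    factors eliminates the concentrations without dividing by \<open>A - K\<close> or
    \<open>B - K\<close>, which may vanish.\<close>
  have "(1 - w) * (A - K) * (B - K) = \<Phi> $ 1 * (A - K) * (B - K) + \<Phi> $ 2 * (B - K) * (A - K)"
    by (simp add: w total_def algebra_simps)
  also have "\<dots> = c 1 * w * (B - K) + c 2 * w * (A - K)"
    unfolding A' B' ..
  finally have "(1 - w) * (A - K) * (B - K) = c 1 * w * (B - K) + c 2 * w * (A - K)" .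
  then show ?thesis
    using w0 by (simp add: contact_terms_def Let_def A_def B_def powr_add algebra_simps)
qed

text \<open>If \<open>\<phi>\<close> took two values on \<open>C\<close>, by connectedness it would
  take all values between them, and the power equation would hold on an interval of
  \<open>w\<close>.\<close>

lemma contact_total_constant:
  assumes "family_contact_manifold vinf n i C" "\<Phi> \<in> C" "\<Psi> \<in> C"
  shows "total \<Phi> = total \<Psi>"
proof (rule ccontr)
  assume "total \<Phi> \<noteq> total \<Psi>"
  define s1 where "s1 = min (total \<Phi>) (total \<Psi>)"
  define s2 where "s2 = max (total \<Phi>) (total \<Psi>)"
  have s12: "s1 < s2" using \<open>total \<Phi> \<noteq> total \<Psi>\<close> by (auto simp: s1_def s2_def)
  obtain \<Phi>o where o: "\<Phi>o \<in> C" "integral_curve vinf n i C"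
    "\<And>\<Phi>. \<Phi> \<in> C \<Longrightarrow> rankine_hugoniot vinf n \<Phi>o \<Phi> (lam i \<Phi>o)"
    using assms(1) unfolding family_contact_manifold_def maximal_integral_curve_def by blast
  obtain I \<gamma> \<gamma>' where C: "C = \<gamma> ` I" and "regular_curve vinf n i I \<gamma> \<gamma>'"
    using integral_curveE[OF o(2)] .
  then interpret regular_curve vinf n i I \<gamma> \<gamma>' by simp
  have "connected (total ` C)"
    using connected_continuous_image[OF total_continuous is_interval_connected[OF interval]]
    by (simp only: C image_image)
  moreover have "s1 \<in> total ` C" "s2 \<in> total ` C"
    using assms(2,3) by (auto simp: s1_def s2_def min_def max_def)
  ultimately have attained: "{s1..s2} \<subseteq> total ` C" by (rule connected_contains_Icc)
  have "s2 \<le> 1" using phase assms(2,3) C by (auto simp: s2_def phase_space_def)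
  define l where "l = lam i \<Phi>o"
  define c where "c j = \<Phi>o $ j * (v j \<Phi>o - l)" for j
  have c: "\<Phi>' $ j * (v j \<Phi>' - l) = c j" if "\<Phi>' \<in> C" for \<Phi>' j
  proof -
    have "flux vinf n \<Phi>' $ j - flux vinf n \<Phi>o $ j = l * (\<Phi>' $ j - \<Phi>o $ j)"
    proof -
      have "(flux vinf n \<Phi>' - flux vinf n \<Phi>o) $ j = (l *\<^sub>R (\<Phi>' - \<Phi>o)) $ j"
        using o(3)[OF that] by (simp only: rankine_hugoniot_def l_def)
      then show ?thesis by simp
    qed
    then show ?thesis by (simp add: flux_def c_def algebra_simps)
  qed
  \<comment> \<open>Since \<open>n $ 1\<close> and \<open>n $ 2\<close> exceed 1, the exponent
    \<open>n $ 1 + n $ 2 + 1\<close> is larger than all the others.\<close>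
  have "- (vinf $ 1 * vinf $ 2) = 0"
  proof (rule generalized_polynomial_top_coeff_zero[where a = "1 - s2" and b = "1 - s1"])
    show "0 \<le> 1 - s2" "1 - s2 < 1 - s1" using s12 \<open>s2 \<le> 1\<close> by auto
  next
    fix w assume w: "1 - s2 < w" "w < 1 - s1"
    then have "1 - w \<in> total ` C" using attained by auto
    then obtain \<Phi>' where \<Phi>': "\<Phi>' \<in> C" "total \<Phi>' = 1 - w" by auto
    then show "- (vinf $ 1 * vinf $ 2) * w powr (n $ 1 + n $ 2 + 1)
        + (\<Sum>(d, e)\<leftarrow>contact_terms (l + c 1 + c 2) (c 1) (c 2). d * w powr e) = 0"
      using w \<open>s2 \<le> 1\<close> by (intro contact_power_equation[OF c[OF \<Phi>'(1)]]) auto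
  qed (use n in \<open>auto simp: contact_terms_def Let_def\<close>)
  then show False using vinf by simp
qed

section \<open>Classification, existence and representatives\<close>

lemma boundary_inf_eq: "boundary_inf = level 1"
  by (simp add: boundary_inf_def level_def)

text \<open>Constancy of \<open>\<phi>\<close> places \<open>C\<close> in one level line. An
  interior time has a tangent along that line, which selects the line, and maximality rules out a
  proper part of it.\<close>

lemma contact_manifold_cases:
  assumes "contact_manifold vinf n C"
  shows "C = level 1 \<or> C = level px"
proof -
  obtain i where fam: "family_contact_manifold vinf n i C"
    using assms unfolding contact_manifold_def by blast
  then have max: "integral_curve vinf n i C" "\<And>C'. integral_curve vinf n i C' \<Longrightarrow> \<not> C \<subset> C'"
    unfolding family_contact_manifold_def maximal_integral_curve_def by blast+
  obtain I \<gamma> \<gamma>' where C: "C = \<gamma> ` I" and "regular_curve vinf n i I \<gamma> \<gamma>'"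
    using integral_curveE[OF max(1)] .
  then interpret regular_curve vinf n i I \<gamma> \<gamma>' by simp
  obtain a b where ab: "a \<in> I" "b \<in> I" "a < b" using nondegenerate by blast
  define t where "t = (a + b) / 2"
  have t: "interior_time t" using ab unfolding interior_time_def t_def by (intro bexI[of _ a] bexI[of _ b]) auto
  have const: "total (\<gamma> s) = total (\<gamma> t)" if "s \<in> I" for s
    using contact_total_constant[OF fam] that interior_time_in[OF t] C by blast
  have sub: "C \<subseteq> level (total (\<gamma> t))"
    using const phase C by (auto simp: level_iff)
  show ?thesis
  proof (cases "total (\<gamma> t) = 1")
    case True
    \<comment> \<open>\<open>level 1\<close> is an integral curve of either family, so maximality
      applies for both values of \<open>i\<close>.\<close>
    then show ?thesis using sub max(2)[OF integral_curve_level_one] by auto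
  next
    case False
    then have less: "total (\<gamma> t) < 1"
      using phase[OF interior_time_in[OF t]] by (simp add: phase_space_def)
    have "total (\<gamma>' t) = 0"
      using interior_total_extremum[OF t] const by simp
    \<comment> \<open>This also yields \<open>i = 2\<close>, so \<open>level px\<close> competes
      with \<open>C\<close> in the same family.\<close>
    from eigen_direction_along_level[OF phase[OF interior_time_in[OF t]] less this eigen[OF interior_time_in[OF t]]]
    show ?thesis using sub max(2)[of "level px"] integral_curve_level_phi_x by auto
  qed
qed

text \<open>When the flux is \<open>l\<close> times the state along the line, any two of its states
  satisfy the jump condition with speed \<open>l\<close>; only maximality then needs an argument,
  supplied by \<open>ext\<close>.\<close>

lemma family_contact_manifold_level:
  assumes "0 < s" "s \<le> 1" "integral_curve vinf n i (level s)"
    and ext: "\<And>I \<gamma> \<gamma>'. regular_curve vinf n i I \<gamma> \<gamma>' \<Longrightarrow> level s \<subseteq> \<gamma> ` I \<Longrightarrow> \<gamma> ` I \<subseteq> level s"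
    and flux: "\<And>\<Phi>. \<Phi> \<in> level s \<Longrightarrow> flux vinf n \<Phi> = l *\<^sub>R \<Phi>"
    and lam: "\<And>\<Phi>. \<Phi> \<in> level s \<Longrightarrow> lam i \<Phi> = l"
  shows "family_contact_manifold vinf n i (level s)"
proof -
  have "vector [s, 0] \<in> level s"
    using assms(1,2) by (auto simp: level_def phase_space_def total_def)
  then obtain \<Phi>o where o: "\<Phi>o \<in> level s" by blast
  have "maximal_integral_curve vinf n i (level s)"
    unfolding maximal_integral_curve_def
  proof (intro conjI assms(3) notI, elim exE conjE)
    fix C' assume C': "integral_curve vinf n i C'" "level s \<subset> C'"
    obtain I \<gamma> \<gamma>' where "C' = \<gamma> ` I" "regular_curve vinf n i I \<gamma> \<gamma>'"
      using integral_curveE[OF C'(1)] .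
    then show False using ext C'(2) by blast
  qed
  moreover have rh: "rankine_hugoniot vinf n \<Phi>o \<Phi> (lam i \<Phi>o)" if "\<Phi> \<in> level s" for \<Phi>
    unfolding rankine_hugoniot_def using flux lam o that by (simp add: scaleR_diff_right)
  moreover have "level s \<subseteq> hugoniot_locus vinf n \<Phi>o"
    using rh unfolding hugoniot_locus_def level_iff subset_iff by blast
  ultimately show ?thesis
    unfolding family_contact_manifold_def using o lam by (intro bexI[of _ \<Phi>o]) auto
qed

lemma contact_manifold_level_one: "contact_manifold vinf n (level 1)"
  unfolding contact_manifold_def
proof
  show "family_contact_manifold vinf n 1 (level 1)"
  proof (rule family_contact_manifold_level[where l = 0])
    show "\<gamma> ` I \<subseteq> level 1" if "regular_curve vinf n 1 I \<gamma> \<gamma>'" "level 1 \<subseteq> \<gamma> ` I" for I \<gamma> \<gamma>'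
      using regular_curve.level_one_not_extendable[OF that(1) refl that(2)] .
  qed (simp_all add: level_iff total_eq_one integral_curve_level_one)
qed

lemma contact_manifold_level_phi_x: "contact_manifold vinf n (level px)"
  unfolding contact_manifold_def
proof
  show "family_contact_manifold vinf n 2 (level px)"
  \<comment> \<open>The speed is the common velocity \<open>u 1 \<Phi> * (1 - px)\<close>, written
    without reference to the state.\<close>
  proof (rule family_contact_manifold_level[where l = "vinf $ 1 * (1 - px) powr (n $ 1 - 1) * (1 - px)"])
    fix \<Phi> assume "\<Phi> \<in> level px"
    then have \<Phi>: "\<Phi> \<in> phase_space" "total \<Phi> = px" by (auto simp: level_iff)
    show "lam 2 \<Phi> = vinf $ 1 * (1 - px) powr (n $ 1 - 1) * (1 - px)"
      using level_phi_x(5)[OF \<Phi>] \<Phi>(2) by (simp add: vel_u_def)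
    show "flux vinf n \<Phi> = (vinf $ 1 * (1 - px) powr (n $ 1 - 1) * (1 - px)) *\<^sub>R \<Phi>"
      using level_phi_x(2)[OF \<Phi>] \<Phi>(2) by (simp add: flux_def vel_u_def vec_eq_iff)
  next
    show "\<gamma> ` I \<subseteq> level px" if "regular_curve vinf n 2 I \<gamma> \<gamma>'" "level px \<subseteq> \<gamma> ` I" for I \<gamma> \<gamma>'
      using regular_curve.level_phi_x_not_extendable[OF that(1) refl that(2)] .
  qed (use phi_x_bounds integral_curve_level_phi_x in simp_all)
qed

text \<open>A state with \<open>\<phi> < 1\<close> and equal velocities lies on the line
  \<open>\<phi> = px\<close>, where the velocity is positive rather than zero.\<close>

lemma represents_level_one:
  assumes "\<Phi> \<in> level 1"
  shows "represents vinf n \<Phi> (level 1)"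
proof -
  have "\<Psi> \<in> level 1" if "\<Psi> \<in> equal_velocity_set vinf n \<Phi>" for \<Psi>
  proof (rule ccontr)
    assume "\<Psi> \<notin> level 1"
    with that have \<Psi>: "\<Psi> \<in> phase_space" "total \<Psi> < 1" "v 1 \<Psi> = v 2 \<Psi>" "v 2 \<Psi> = 0"
      using assms total_eq_one(2)[of \<Phi>] by (auto simp: equal_velocity_set_def level_iff phase_space_def)
    then have "u 1 \<Psi> = u 2 \<Psi>" by (simp add: vel_eq)
    then have "total \<Psi> = px" using vel_u_eq_iff[OF \<Psi>(2)] by simp
    from level_phi_x(2)[OF \<Psi>(1) this, of 2] show False
      using vel_u_pos[OF \<Psi>(2), of 1] phi_x_bounds \<Psi>(4) by simp
  qed
  moreover have "\<Psi> \<in> equal_velocity_set vinf n \<Phi>" if "\<Psi> \<in> level 1" for \<Psi>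
    using that assms by (simp add: equal_velocity_set_def level_iff total_eq_one)
  ultimately have "level 1 = equal_velocity_set vinf n \<Phi>" by blast
  moreover have "\<Phi> \<in> phase_space" "v 1 \<Phi> = v 2 \<Phi>"
    using assms by (simp_all add: level_iff total_eq_one)
  ultimately show ?thesis by (simp add: represents_def)
qed

text \<open>Positivity of the common velocity excludes \<open>\<phi> = 1\<close>; below it, equal
  velocities mean \<open>u 1 = u 2\<close>, which determines \<open>\<phi>\<close>.\<close>

lemma represents_level_phi_x:
  assumes "\<Phi> \<in> level px"
  shows "represents vinf n \<Phi> (level px)"
proof -
  have \<Phi>: "\<Phi> \<in> phase_space" "total \<Phi> = px" using assms by (auto simp: level_iff)
  have u: "u 1 \<Psi> = u 1 \<Phi>" if "\<Psi> \<in> level px" for \<Psi>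
    using that \<Phi> by (simp add: vel_u_def level_iff)
  have pos: "0 < v j \<Phi>" for j
    using level_phi_x(2)[OF \<Phi>, of j] vel_u_pos[of \<Phi> 1] \<Phi>(2) phi_x_bounds by simp
  have "\<Psi> \<in> level px" if "\<Psi> \<in> equal_velocity_set vinf n \<Phi>" for \<Psi>
  proof -
    from that have \<Psi>: "\<Psi> \<in> phase_space" "v 1 \<Psi> = v 2 \<Psi>" "v 2 \<Psi> = v 1 \<Phi>"
      by (auto simp: equal_velocity_set_def)
    have "total \<Psi> \<noteq> 1" using total_eq_one(2)[of \<Psi> 2] \<Psi>(3) pos[of 1] by auto
    then have "total \<Psi> < 1" using \<Psi>(1) by (simp add: phase_space_def)
    moreover have "u 1 \<Psi> = u 2 \<Psi>" using \<Psi>(2) by (simp add: vel_eq)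
    ultimately show ?thesis using vel_u_eq_iff \<Psi>(1) by (simp add: level_iff)
  qed
  moreover have "\<Psi> \<in> equal_velocity_set vinf n \<Phi>" if "\<Psi> \<in> level px" for \<Psi>
  proof -
    have \<Psi>: "\<Psi> \<in> phase_space" "total \<Psi> = px" using that by (auto simp: level_iff)
    show ?thesis
      using level_phi_x(2)[OF \<Psi>] level_phi_x(2)[OF \<Phi>] u[OF that] \<Psi>(1)
      by (simp add: equal_velocity_set_def)
  qed
  ultimately have "level px = equal_velocity_set vinf n \<Phi>" by blast
  then show ?thesis
    using \<Phi>(1) level_phi_x(2)[OF \<Phi>] by (simp add: represents_def)
qed

lemma Phi_x_in_level: "Phi_x vinf n \<in> level px"
  using phi_x_bounds by (simp add: level_def phase_space_def total_def Phi_x_def)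

lemma level_one_neq: "level 1 \<noteq> level px"
proof
  assume "level 1 = level px"
  then have "Phi_x vinf n \<in> level 1" using Phi_x_in_level by simp
  then show False using Phi_x_in_level phi_x_bounds by (simp add: level_iff)
qed

end

theorem lemma3:
  fixes vinf n :: "real ^ 2"
  assumes "vinf $ 1 > vinf $ 2" and "vinf $ 2 > 0"
    and "n $ 1 > n $ 2" and "n $ 2 > 1"
  shows "{C. contact_manifold vinf n C} =
           {boundary_inf, {\<Phi> \<in> phase_space. \<Phi> $ 1 + \<Phi> $ 2 = phi_x vinf n}}
       \<and> boundary_inf \<noteq> {\<Phi> \<in> phase_space. \<Phi> $ 1 + \<Phi> $ 2 = phi_x vinf n}
       \<and> (\<forall>\<Phi>inf\<in>boundary_inf. represents vinf n \<Phi>inf boundary_inf)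
       \<and> represents vinf n (Phi_x vinf n) {\<Phi> \<in> phase_space. \<Phi> $ 1 + \<Phi> $ 2 = phi_x vinf n}"
proof -
  interpret two_species vinf n using assms by unfold_locales
  have "{C. contact_manifold vinf n C} = {level 1, level px}"
    using contact_manifold_cases contact_manifold_level_one contact_manifold_level_phi_x by blast
  then show ?thesis
    unfolding boundary_inf_eq level_def[of px, symmetric]
    using level_one_neq represents_level_one represents_level_phi_x[OF Phi_x_in_level] by simp
qed

end
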